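(* For every integer $n>2$, $$b_e(1,n)+b_e(1,n-2)=\overline{p}_e(n-1)+c_o(n-1)$$ and $$b_o(1,n)+b_o(1,n-2)=\overline{p}_e(n-1)+c_e(n-1).$$
   Context: A partition of a positive integer $n$ is a non-increasing sequence of positive integers (its parts) with sum $n$. An overpartition of $n$ is a partition of $n$ in which the first occurrence of each part size may be overlined or not. Thus, for each part size, at most one copy is overlined. For example, the overpartitions of $2$ are $(2),(\overline{2}),(1,1),(\overline{1},1)$. Comparisons of size and parity of parts refer to the underlying integers, ignoring overlines. Parts are counted with multiplicity, and both overlined and non-overlined parts are counted. For positive integers $k$ and $n$, let $\overline{\mathrm{Spt}}k_o(n)$ be the set of overpartitions $\pi$ of $n$ (having at least one non-overlined part) such that: the smallest non-overlined part, denoted $s(\pi)$, appears exactly $k$ times; every overlined part is strictly bigger than $s(\pi)$; and all parts other than $s(\pi)$ are incongruent to $s(\pi)$ modulo $2$. There may be no parts other than $s(\pi)$. Let $b_e(k,n)$ (resp. $b_o(k,n)$) be the number of overpartitions $\pi\in\overline{\mathrm{Spt}}k_o(n)$ for which the number of parts greater than $s(\pi)$ is even (resp. odd). Zero counts as even. Let $\overline{p}_e(n)$ be the number of overpartitions of $n$ all of whose parts are even. Let $c_e(n)$ (resp. $c_o(n)$) be the number of overpartitions of $n$ all of whose parts are odd, containing no non-overlined $1$'s (an overlined $\overline{1}$ is allowed), and having an even (resp. odd) total number of parts. *)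

theory Defs
  imports Main "HOL-Library.Multiset"
begin

text \<open>
  An overpartition is encoded as a pair \<open>(L, V)\<close>: \<open>L\<close> is the underlying partition, the multiset
  of all parts (overlined or not), and \<open>V\<close> is the set of those part sizes whose first occurrence
  is overlined.
\<close>

type_synonym overpartition = "nat multiset \<times> nat set"

definition parts :: "overpartition \<Rightarrow> nat multiset" where
  "parts p = fst p"

definition overlined :: "overpartition \<Rightarrow> nat set" where
  "overlined p = snd p"

definition nonoverlined :: "overpartition \<Rightarrow> nat multiset" where
  "nonoverlined p = parts p - mset_set (overlined p)"

definition overpartitions :: "nat \<Rightarrow> overpartition set" where
  "overpartitions n =
     {p. (\<forall>x\<in>#parts p. 0 < x) \<and> sum_mset (parts p) = n \<and> overlined p \<subseteq> set_mset (parts p)}"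

text \<open>Only meaningful if there is at least one non-overlined part.\<close>

definition smallest :: "overpartition \<Rightarrow> nat" where
  "smallest p = Min (set_mset (nonoverlined p))"

definition Sptko :: "nat \<Rightarrow> nat \<Rightarrow> overpartition set" where
  "Sptko k n =
     {p \<in> overpartitions n.
        nonoverlined p \<noteq> {#} \<and>
        count (nonoverlined p) (smallest p) = k \<and>
        (\<forall>x\<in>overlined p. smallest p < x) \<and>
        (\<forall>x\<in>#parts p. x \<noteq> smallest p \<longrightarrow> x mod 2 \<noteq> smallest p mod 2)}"

definition num_greater :: "overpartition \<Rightarrow> nat" where
  "num_greater p = size {#x \<in># parts p. smallest p < x#}"

definition b_e :: "nat \<Rightarrow> nat \<Rightarrow> nat" where
  "b_e k n = card {p \<in> Sptko k n. even (num_greater p)}"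

definition b_o :: "nat \<Rightarrow> nat \<Rightarrow> nat" where
  "b_o k n = card {p \<in> Sptko k n. odd (num_greater p)}"

definition pbar_e :: "nat \<Rightarrow> nat" where
  "pbar_e n = card {p \<in> overpartitions n. \<forall>x\<in>#parts p. even x}"

definition C :: "nat \<Rightarrow> overpartition set" where
  "C n = {p \<in> overpartitions n. (\<forall>x\<in>#parts p. odd x) \<and> 1 \<notin># nonoverlined p}"

definition c_e :: "nat \<Rightarrow> nat" where
  "c_e n = card {p \<in> C n. even (size (parts p))}"

definition c_o :: "nat \<Rightarrow> nat" where
  "c_o n = card {p \<in> C n. odd (size (parts p))}"

text \<open>All of the cardinalities above are those of finite sets.\<close>

lemma finite_overpartitions: "finite (overpartitions n)"
proof -
  have "overpartitions n \<subseteq> mset ` {xs. set xs \<subseteq> {..n} \<and> length xs \<le> n} \<times> Pow {..n}"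
  proof
    fix p assume p: "p \<in> overpartitions n"
    obtain xs where xs: "mset xs = parts p" using ex_mset by blast
    have pos: "\<forall>x\<in>set xs. 0 < x" and sum: "sum_list xs = n" and ov: "overlined p \<subseteq> set xs"
      using p by (auto simp: overpartitions_def sum_mset_sum_list simp flip: xs)
    have "length xs \<le> sum_list xs" using pos by (induction xs) (auto simp: Suc_le_eq)
    moreover have "set xs \<subseteq> {..n}" using sum member_le_sum_list by fastforce
    ultimately show "p \<in> mset ` {xs. set xs \<subseteq> {..n} \<and> length xs \<le> n} \<times> Pow {..n}"
      using sum ov xs by (cases p) (auto simp: parts_def overlined_def)
  qed
  moreover have "finite {xs. set xs \<subseteq> {..n} \<and> length xs \<le> n}"
    by (rule finite_lists_length_le) simp
  ultimately show ?thesis by (meson finite_Pow_iff finite_SigmaI finite_atMost finite_imageI finite_subset)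
qed

end

theory Submission
  imports Defs
begin

text \<open>
  The proof is bijective. An overpartition in \<open>Sptko 1 n\<close> consists of its smallest part \<open>s\<close>, which
  is not overlined, and an overpartition into parts that exceed \<open>s\<close> and have the other parity. The
  part \<open>s\<close> is the only one of its parity, so moving it by one unit gives an overpartition whose parts
  all have the same parity. This is done in three ways, each of which yields an overpartition
  of \<open>n - 1\<close>.

  \<^item> If \<open>p \<in> Sptko 1 n\<close> has \<open>s = 1\<close>, delete \<open>s\<close>. The remaining parts form an arbitrary overpartition
    into even parts, and their number is \<open>num_greater p\<close>.

  \<^item> If \<open>p \<in> Sptko 1 n\<close> has \<open>s \<ge> 2\<close>, replace \<open>s\<close> by an overlined \<open>s - 1\<close>. The results are the
    overpartitions into parts of one parity whose smallest part has no non-overlined copy.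

  \<^item> If \<open>p \<in> Sptko 1 (n - 2)\<close>, replace \<open>s\<close> by a non-overlined \<open>s + 1\<close>. The results are the
    overpartitions into parts of one parity whose smallest part has a non-overlined copy and is
    not \<open>1\<close>.

  The last two cases together produce every overpartition of \<open>n - 1\<close> with parts of one parity and
  without non-overlined \<open>1\<close>, exactly once: those with even parts, and those counted
  by \<open>c_e\<close> and \<open>c_o\<close>. They raise the number of parts from \<open>num_greater p\<close> to \<open>num_greater p + 1\<close>,
  while the first case leaves it alone. Hence the even overpartitions with an even number of parts
  come from one case and those with an odd number from another, so that together they contribute
  all of \<open>pbar_e (n - 1)\<close>, and the parity switches between \<open>b_e\<close> and \<open>c_o\<close>, and between \<open>b_o\<close>
  and \<open>c_e\<close>.
\<close>

section \<open>Non-overlined parts and counting along bijections\<close>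

lemma mem_nonoverlined_iff:
  assumes "V \<subseteq> set_mset L"
  shows "x \<in># nonoverlined (L, V) \<longleftrightarrow> x \<in># L \<and> (x \<in> V \<longrightarrow> 2 \<le> count L x)"
proof -
  have "finite V" using assms finite_subset by blast
  then have "count (nonoverlined (L, V)) x = count L x - (if x \<in> V then 1 else 0)"
    by (simp add: nonoverlined_def parts_def overlined_def)
  moreover have "x \<in># L \<longleftrightarrow> 0 < count L x" by simp
  ultimately show ?thesis by (simp flip: count_greater_zero_iff) linarith
qed

lemma Min_add_mset:
  fixes s :: nat
  assumes "\<And>x. x \<in># M \<Longrightarrow> s \<le> x"
  shows "Min (set_mset (add_mset s M)) = s"
  using assms by (intro Min_eqI) auto

lemma card_filter_bij_betw:
  assumes "bij_betw f A B" and "\<And>a. a \<in> A \<Longrightarrow> st (f a) = st' a"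
  shows "card {a \<in> A. Q (st' a)} = card {b \<in> B. Q (st b)}"
proof -
  have "bij_betw f {a \<in> A. Q (st' a)} {b \<in> B. Q (st b)}"
    using assms unfolding bij_betw_def inj_on_def by auto
  then show ?thesis by (rule bij_betw_same_card)
qed

lemma card_filter_disjoint_Un:
  assumes "finite A" "finite B" "A \<inter> B = {}"
  shows "card {x \<in> A \<union> B. Q x} = card {x \<in> A. Q x} + card {x \<in> B. Q x}"
proof -
  have "{x \<in> A \<union> B. Q x} = {x \<in> A. Q x} \<union> {x \<in> B. Q x}" by blast
  with assms show ?thesis by (simp add: card_Un_disjoint disjoint_iff)
qed

section \<open>Splitting off the smallest part\<close>

text \<open>
  The coordinates \<open>(s, M, V)\<close> separate the smallest part \<open>s\<close> from the overpartition \<open>(M, V)\<close>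
  of larger parts, so that each of the three transformations only acts on \<open>s\<close>.
\<close>

definition split_spt :: "nat \<Rightarrow> (nat \<times> overpartition) set" where
  "split_spt n = {(s, M, V). 0 < s \<and> (\<forall>x\<in>#M. s < x \<and> odd (x + s)) \<and>
                             s + sum_mset M = n \<and> V \<subseteq> set_mset M}"

lemma split_sptD:
  assumes "(s, M, V) \<in> split_spt n"
  shows "0 < s" "\<And>x. x \<in># M \<Longrightarrow> s < x" "\<And>x. x \<in># M \<Longrightarrow> odd (x + s)"
    "s + sum_mset M = n" "V \<subseteq> set_mset M"
  using assms by (auto simp: split_spt_def)

definition larger_parts :: "nat \<times> overpartition \<Rightarrow> nat" where
  "larger_parts t = size (parts (snd t))"

lemma smallest_join:
  assumes "(s, M, V) \<in> split_spt n"
  shows "smallest (add_mset s M, V) = s"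
proof -
  have V: "V \<subseteq> set_mset (add_mset s M)" using assms by (auto simp: split_spt_def)
  have "s \<notin> V" using assms by (auto simp: split_spt_def)
  then show ?thesis
    using assms unfolding smallest_def
    by (intro Min_eqI) (auto simp: mem_nonoverlined_iff[OF V] split_spt_def less_imp_le)
qed

lemma num_greater_join:
  assumes "(s, M, V) \<in> split_spt n"
  shows "num_greater (add_mset s M, V) = size M"
proof -
  have "filter_mset ((<) s) M = M"
    using assms by (intro filter_mset_eq_conv[THEN iffD2]) (auto simp: split_spt_def)
  then show ?thesis
    by (simp add: num_greater_def smallest_join[OF assms] parts_def)
qed

lemma join_in_Sptko:
  assumes "(s, M, V) \<in> split_spt n"
  shows "(add_mset s M, V) \<in> Sptko 1 n"
proof -
  have t: "0 < s" "\<forall>x\<in>#M. s < x \<and> odd (x + s)" "s + sum_mset M = n" "V \<subseteq> set_mset M"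
    using assms by (auto simp: split_spt_def)
  have V: "V \<subseteq> set_mset (add_mset s M)" "s \<notin> V" "finite V" "s \<notin># M"
    using t finite_subset[OF t(4)] by auto
  have "s \<in># nonoverlined (add_mset s M, V)"
    using V by (simp add: mem_nonoverlined_iff)
  moreover have "count (nonoverlined (add_mset s M, V)) s = 1"
    using V by (simp add: nonoverlined_def parts_def overlined_def not_in_iff)
  moreover have "(add_mset s M, V) \<in> overpartitions n"
    using t by (auto simp: overpartitions_def parts_def overlined_def)
  moreover have "x mod 2 \<noteq> s mod 2" if "x \<in># parts (add_mset s M, V)" "x \<noteq> s" for x
  proof -
    have "odd (x + s)" using t(2) that by (simp add: parts_def)
    then show ?thesis by presburger
  qed
  moreover have "\<forall>x\<in>overlined (add_mset s M, V). s < x"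
    using t(2,4) by (auto simp: overlined_def)
  ultimately show ?thesis
    unfolding Sptko_def mem_Collect_eq smallest_join[OF assms] by (metis (no_types) empty_iff set_mset_empty)
qed

lemma Sptko_split:
  assumes "(L, V) \<in> Sptko 1 n"
  obtains s M where "L = add_mset s M" "(s, M, V) \<in> split_spt n"
proof -
  define s where "s = smallest (L, V)"
  define M where "M = L - {#s#}"
  have p: "\<forall>x\<in>#L. 0 < x" "sum_mset L = n" "V \<subseteq> set_mset L"
      "nonoverlined (L, V) \<noteq> {#}" "count (nonoverlined (L, V)) s = 1" "\<forall>x\<in>V. s < x"
      "\<forall>x\<in>#L. x \<noteq> s \<longrightarrow> x mod 2 \<noteq> s mod 2"
    using assms by (auto simp: Sptko_def overpartitions_def parts_def overlined_def s_def)
  have fin: "finite V" using p(3) finite_subset by blast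
  have "s \<in># nonoverlined (L, V)"
    using p(4) by (simp add: s_def smallest_def)
  then have L: "L = add_mset s M"
    by (simp add: M_def mem_nonoverlined_iff[OF p(3)])
  have sV: "s \<notin> V" using p(6) by auto
  then have "count L s = 1"
    using p(5) fin by (simp add: nonoverlined_def parts_def overlined_def)
  then have sM: "s \<notin># M" by (simp add: L not_in_iff)
  have gt: "s < x" if "x \<in># M" for x
  proof (cases "x \<in> V")
    case False
    then have "x \<in># nonoverlined (L, V)" using that mem_nonoverlined_iff[OF p(3), of x] by (simp add: L)
    then have "s \<le> x" by (simp add: s_def smallest_def)
    then show ?thesis using sM that by (metis le_neq_implies_less)
  qed (use p in auto)
  have "odd (x + s)" if "x \<in># M" for x
  proof -
    have "x mod 2 \<noteq> s mod 2" using p(7) that sM by (auto simp: L)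
    then show ?thesis by (metis even_add mod2_eq_if)
  qed
  then have "(s, M, V) \<in> split_spt n"
    using p gt sV by (auto simp: split_spt_def L)
  with L show ?thesis using that by blast
qed

lemma bij_betw_join:
  "bij_betw (\<lambda>(s, M, V). (add_mset s M, V)) (split_spt n) (Sptko 1 n)"
proof (rule bij_betw_imageI)
  show "inj_on (\<lambda>(s, M, V). (add_mset s M, V)) (split_spt n)"
  proof (rule inj_onI, clarsimp)
    fix s M V s' M'
    assume t: "(s, M, V) \<in> split_spt n" "(s', M', V) \<in> split_spt n"
      and eq: "add_mset s M = add_mset s' M'"
    have "s = s'" using smallest_join[OF t(1)] smallest_join[OF t(2)] eq by simp
    then show "s = s' \<and> M = M'" using eq by simp
  qed
  show "(\<lambda>(s, M, V). (add_mset s M, V)) ` split_spt n = Sptko 1 n"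
  proof (intro equalityI subsetI)
    fix p assume "p \<in> Sptko 1 n"
    moreover obtain L V where p: "p = (L, V)" by fastforce
    ultimately obtain s M where "L = add_mset s M" "(s, M, V) \<in> split_spt n"
      using Sptko_split by blast
    then show "p \<in> (\<lambda>(s, M, V). (add_mset s M, V)) ` split_spt n"
      unfolding p by (intro image_eqI[where x="(s, M, V)"]) simp_all
  next
    fix p assume "p \<in> (\<lambda>(s, M, V). (add_mset s M, V)) ` split_spt n"
    then obtain s M V where "(s, M, V) \<in> split_spt n" "p = (add_mset s M, V)" by auto
    then show "p \<in> Sptko 1 n" using join_in_Sptko by blast
  qed
qed

lemma finite_split_spt: "finite (split_spt n)"
proof -
  have "Sptko 1 n \<subseteq> overpartitions n" by (auto simp: Sptko_def)
  then show ?thesis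
    using bij_betw_finite[OF bij_betw_join, of n] finite_subset[OF _ finite_overpartitions, of _ n]
    by simp
qed

lemma card_Sptko_eq_split_spt:
  "card {p \<in> Sptko 1 n. Q (num_greater p)} = card {t \<in> split_spt n. Q (larger_parts t)}"
  by (rule card_filter_bij_betw[OF bij_betw_join, where Q=Q and st=num_greater and st'=larger_parts, symmetric])
     (auto simp: num_greater_join larger_parts_def parts_def)

section \<open>The three transformations of the smallest part\<close>

definition even_overpartitions :: "nat \<Rightarrow> overpartition set" where
  "even_overpartitions n = {p \<in> overpartitions n. \<forall>x\<in>#parts p. even x}"

definition uniform_overpartitions :: "nat \<Rightarrow> overpartition set" where
  "uniform_overpartitions n =
     {p \<in> overpartitions n. (\<forall>x\<in>#parts p. \<forall>y\<in>#parts p. even (x + y)) \<and> 1 \<notin># nonoverlined p}"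

definition min_overlined_only :: "overpartition \<Rightarrow> bool" where
  "min_overlined_only p \<longleftrightarrow> Min (set_mset (parts p)) \<notin># nonoverlined p"

text \<open>
  Deletion of the part \<open>1\<close> can be undone on every overpartition into even parts: such parts exceed
  \<open>1\<close> and have the other parity.
\<close>

lemma bij_betw_delete_one:
  assumes "0 < n"
  shows "bij_betw snd {t \<in> split_spt n. fst t = 1} (even_overpartitions (n - 1))"
proof (rule bij_betw_byWitness[where f' = "Pair 1"])
  have "(1, p) \<in> split_spt n" if "p \<in> even_overpartitions (n - 1)" for p
  proof -
    have "0 < x \<and> 1 < x" if "x \<in># parts p" for x
    proof -
      from that \<open>p \<in> _\<close> have "0 < x" "even x"
        by (auto simp: even_overpartitions_def overpartitions_def)
      then show ?thesis by presburger
    qed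
    then show ?thesis
      using that assms
      by (cases p) (auto simp: split_spt_def even_overpartitions_def overpartitions_def parts_def overlined_def)
  qed
  then show "Pair 1 ` even_overpartitions (n - 1) \<subseteq> {t \<in> split_spt n. fst t = 1}" by auto
  show "snd ` {t \<in> split_spt n. fst t = 1} \<subseteq> even_overpartitions (n - 1)"
  proof
    fix p assume "p \<in> snd ` {t \<in> split_spt n. fst t = 1}"
    then obtain M V where p: "p = (M, V)" and t: "(1, M, V) \<in> split_spt n" by auto
    show "p \<in> even_overpartitions (n - 1)"
      unfolding even_overpartitions_def overpartitions_def parts_def overlined_def mem_Collect_eq
        p fst_conv snd_conv
    proof (intro conjI ballI)
      show "0 < x" "even x" if "x \<in># M" for x
        using split_sptD(2,3)[OF t that] by auto
    qed (use split_sptD(4,5)[OF t] in auto)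
  qed
qed auto

lemma uniform_split_min:
  assumes "(L, V) \<in> uniform_overpartitions n" "0 < n"
  obtains v M where "L = add_mset v M" "Min (set_mset L) = v" "0 < v"
    "\<forall>x\<in>#M. v \<le> x \<and> even (x + v)" "v + sum_mset M = n" "V \<subseteq> set_mset L" "1 \<notin># nonoverlined (L, V)"
proof -
  have p: "\<forall>x\<in>#L. 0 < x" "sum_mset L = n" "V \<subseteq> set_mset L"
      "\<forall>x\<in>#L. \<forall>y\<in>#L. even (x + y)" "1 \<notin># nonoverlined (L, V)"
    using assms(1)
    unfolding uniform_overpartitions_def overpartitions_def parts_def overlined_def mem_Collect_eq
      fst_conv snd_conv
    by blast+
  define v where "v = Min (set_mset L)"
  have "L \<noteq> {#}" using p(2) assms(2) by auto
  then have "v \<in># L" by (simp add: v_def)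
  then obtain M where L: "L = add_mset v M" by (blast dest: multi_member_split)
  have sum: "v + sum_mset M = n" using p(2) unfolding L by simp
  have "v \<le> x" if "x \<in># M" for x
  proof -
    have "x \<in># L" using that by (simp add: L)
    then show ?thesis unfolding v_def by simp
  qed
  moreover have "even (x + v)" if "x \<in># M" for x
  proof -
    have "x \<in># L" using that by (simp add: L)
    then show ?thesis using p(4) \<open>v \<in># L\<close> by blast
  qed
  ultimately show ?thesis
    using that[OF L v_def[symmetric]] p \<open>v \<in># L\<close> sum by blast
qed

text \<open>
  The new part \<open>s - 1\<close> is smaller than every other part, so it is recognisable as the minimum, and
  it has no non-overlined copy. Conversely, if the minimum \<open>v\<close> has no non-overlined copy, then it
  occurs only once, and the gap of at least two to the next part leaves room for \<open>v + 1\<close>.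
\<close>

lemma bij_betw_overlined_pred:
  assumes "1 < n"
  shows "bij_betw (\<lambda>(s, M, V). (add_mset (s - 1) M, insert (s - 1) V))
           {t \<in> split_spt n. fst t \<noteq> 1} {p \<in> uniform_overpartitions (n - 1). min_overlined_only p}"
    (is "bij_betw ?f ?A ?B")
proof (rule bij_betw_imageI)
  show "inj_on ?f ?A"
  proof (rule inj_onI, clarsimp)
    fix s M V s' M' V'
    assume t: "(s, M, V) \<in> split_spt n" "(s', M', V') \<in> split_spt n" "s \<noteq> Suc 0" "s' \<noteq> Suc 0"
      and eq: "add_mset (s - Suc 0) M = add_mset (s' - Suc 0) M'"
      and V: "insert (s - Suc 0) V = insert (s' - Suc 0) V'"
    have lt: "\<And>x. x \<in># M \<Longrightarrow> s < x" "\<And>x. x \<in># M' \<Longrightarrow> s' < x"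
      using split_sptD(2) t(1,2) by blast+
    have "Min (set_mset (add_mset (s - Suc 0) M)) = s - Suc 0"
      by (rule Min_add_mset) (use lt(1) in force)
    moreover have "Min (set_mset (add_mset (s' - Suc 0) M')) = s' - Suc 0"
      by (rule Min_add_mset) (use lt(2) in force)
    ultimately have "s - Suc 0 = s' - Suc 0" by (simp only: eq)
    then have s: "s = s'" using split_sptD(1)[OF t(1)] split_sptD(1)[OF t(2)] by linarith
    have "s - Suc 0 \<notin># M" "s' - Suc 0 \<notin># M'" using lt by force+
    then have "s - Suc 0 \<notin> V" "s' - Suc 0 \<notin> V'"
      using split_sptD(5)[OF t(1)] split_sptD(5)[OF t(2)] by blast+
    then show "s = s' \<and> M = M' \<and> V = V'" using s eq V by (simp add: insert_ident)
  qed
  show "?f ` ?A = ?B"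
  proof (intro equalityI subsetI)
    fix p assume "p \<in> ?f ` ?A"
    then obtain s M V where t: "(s, M, V) \<in> split_spt n" "s \<noteq> 1"
      and p: "p = (add_mset (s - 1) M, insert (s - 1) V)" by auto
    then have c: "0 < s" "\<forall>x\<in>#M. s < x \<and> odd (x + s)" "s + sum_mset M = n" "V \<subseteq> set_mset M"
      by (auto simp: split_spt_def)
    have V: "insert (s - 1) V \<subseteq> set_mset (add_mset (s - 1) M)" using c by auto
    have notin: "s - 1 \<notin># M" using c by fastforce
    have Min: "Min (set_mset (add_mset (s - 1) M)) = s - 1"
      using c by (intro Min_add_mset) fastforce
    have over: "min_overlined_only p"
      unfolding min_overlined_only_def p parts_def fst_conv Min mem_nonoverlined_iff[OF V]
      using notin by (simp add: not_in_iff)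
    have "1 \<notin># nonoverlined p"
      unfolding p mem_nonoverlined_iff[OF V] using c t(2) notin by (auto simp: not_in_iff)
    moreover have par: "even (x + (s - 1))" if "x \<in># add_mset (s - 1) M" for x
      using that c by (auto split: if_splits)
    moreover have "even (x + y)" if "x \<in># add_mset (s - 1) M" "y \<in># add_mset (s - 1) M" for x y
      using par[OF that(1)] par[OF that(2)] by presburger
    moreover have "p \<in> overpartitions (n - 1)"
      using c t(2) by (auto simp: p overpartitions_def parts_def overlined_def)
    ultimately show "p \<in> ?B" using over by (simp add: uniform_overpartitions_def p parts_def)
  next
    fix p assume pB: "p \<in> ?B"
    obtain L V where p: "p = (L, V)" by fastforce
    have pU: "(L, V) \<in> uniform_overpartitions (n - 1)" using pB by (simp add: p)
    obtain v M where L: "L = add_mset v M" and Min: "Min (set_mset L) = v" and v: "0 < v"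
      and M: "\<forall>x\<in>#M. v \<le> x \<and> even (x + v)" and sum: "v + sum_mset M = n - 1"
      and V: "V \<subseteq> set_mset L"
      using uniform_split_min[OF pU] assms by (metis zero_less_diff)
    have "v \<notin># nonoverlined (L, V)"
      using pB Min by (simp add: p min_overlined_only_def parts_def)
    then have vV: "v \<in> V" and "\<not> 2 \<le> count L v"
      using mem_nonoverlined_iff[OF V, of v] L by auto
    then have vM: "v \<notin># M" by (simp add: L Suc_le_eq)
    \<comment> \<open>The parts other than \<open>v\<close> have its parity, so that they also exceed \<open>v + 1\<close>.\<close>
    have "Suc v < x" if "x \<in># M" for x
    proof -
      have "v \<le> x" "x \<noteq> v" "x \<noteq> Suc v" using M vM that by auto
      then show ?thesis by linarith
    qed
    then have "(Suc v, M, V - {v}) \<in> split_spt n"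
      using M sum V assms by (auto simp: split_spt_def L)
    moreover have "p = ?f (Suc v, M, V - {v})" using vV by (auto simp: p L)
    ultimately show "p \<in> ?f ` ?A" using v by (intro image_eqI) auto
  qed
qed

text \<open>
  The new part \<open>s + 1\<close> may coincide with other parts, but none is smaller, so it is still the minimum.
  Conversely, a non-overlined copy of the minimum \<open>v\<close> can be lowered to \<open>v - 1\<close> without touching
  an overlined copy of \<open>v\<close>; excluding a non-overlined \<open>1\<close> means that \<open>v - 1\<close> is positive.
\<close>

lemma bij_betw_nonoverlined_succ:
  assumes "1 < n"
  shows "bij_betw (\<lambda>(s, M, V). (add_mset (s + 1) M, V))
           (split_spt (n - 2)) {p \<in> uniform_overpartitions (n - 1). \<not> min_overlined_only p}"
    (is "bij_betw ?f ?A ?B")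
proof (rule bij_betw_imageI)
  show "inj_on ?f ?A"
  proof (rule inj_onI, clarsimp)
    fix s M V s' M'
    assume t: "(s, M, V) \<in> split_spt (n - 2)" "(s', M', V) \<in> split_spt (n - 2)"
      and eq: "add_mset (Suc s) M = add_mset (Suc s') M'"
    have "Min (set_mset (add_mset (Suc s) M)) = Suc s"
      by (rule Min_add_mset) (use split_sptD(2)[OF t(1)] in force)
    moreover have "Min (set_mset (add_mset (Suc s') M')) = Suc s'"
      by (rule Min_add_mset) (use split_sptD(2)[OF t(2)] in force)
    ultimately have "Suc s = Suc s'" by (simp only: eq)
    then have "s = s'" by simp
    then show "s = s' \<and> M = M'" using eq by simp
  qed
  show "?f ` ?A = ?B"
  proof (intro equalityI subsetI)
    fix p assume "p \<in> ?f ` ?A"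
    then obtain s M V where t: "(s, M, V) \<in> split_spt (n - 2)"
      and p: "p = (add_mset (s + 1) M, V)" by auto
    then have c: "0 < s" "\<forall>x\<in>#M. s < x \<and> odd (x + s)" "s + sum_mset M = n - 2" "V \<subseteq> set_mset M"
      by (auto simp: split_spt_def)
    have V: "V \<subseteq> set_mset (add_mset (s + 1) M)" using c by auto
    have Min: "Min (set_mset (add_mset (s + 1) M)) = s + 1"
      using c by (intro Min_add_mset) auto
    \<comment> \<open>If \<open>s + 1\<close> is also overlined, then that copy was already in \<open>M\<close>, so the new copy
       is not overlined.\<close>
    have "s + 1 \<in> V \<Longrightarrow> s + 1 \<in># M" using c(4) by blast
    then have non: "\<not> min_overlined_only p"
      unfolding min_overlined_only_def p parts_def fst_conv Min mem_nonoverlined_iff[OF V]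
      by (auto simp: Suc_le_eq)
    have "1 \<notin># nonoverlined p"
      unfolding p mem_nonoverlined_iff[OF V] using c by auto
    moreover have par: "odd (x + s)" if "x \<in># add_mset (s + 1) M" for x
      using that c by auto
    moreover have "even (x + y)" if "x \<in># add_mset (s + 1) M" "y \<in># add_mset (s + 1) M" for x y
      using par[OF that(1)] par[OF that(2)] by presburger
    moreover have "p \<in> overpartitions (n - 1)"
      using c assms by (auto simp: p overpartitions_def parts_def overlined_def)
    ultimately show "p \<in> ?B" using non by (simp add: uniform_overpartitions_def p parts_def)
  next
    fix p assume pB: "p \<in> ?B"
    obtain L V where p: "p = (L, V)" by fastforce
    have pU: "(L, V) \<in> uniform_overpartitions (n - 1)" using pB by (simp add: p)
    obtain v M where L: "L = add_mset v M" and Min: "Min (set_mset L) = v" and v: "0 < v"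
      and M: "\<forall>x\<in>#M. v \<le> x \<and> even (x + v)" and sum: "v + sum_mset M = n - 1"
      and V: "V \<subseteq> set_mset L" and one: "1 \<notin># nonoverlined (L, V)"
      using uniform_split_min[OF pU] assms by (metis zero_less_diff)
    have vno: "v \<in># nonoverlined (L, V)"
      using pB Min by (simp add: p min_overlined_only_def parts_def)
    then have "v \<noteq> 1" using one by auto
    then obtain s where s: "v = Suc s" "0 < s" using v by (cases v) auto
    have "v \<in> V \<Longrightarrow> v \<in># M"
      using vno mem_nonoverlined_iff[OF V, of v] by (simp add: L Suc_le_eq)
    then have "V \<subseteq> set_mset M" using V by (auto simp: L)
    then have "(s, M, V) \<in> split_spt (n - 2)"
      using M sum assms s by (auto simp: split_spt_def Suc_le_eq)
    moreover have "p = ?f (s, M, V)" by (simp add: p L s)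
    ultimately show "p \<in> ?f ` ?A" by (intro image_eqI) auto
  qed
qed

section \<open>Counting\<close>

text \<open>
  The only overpartition that is both even and odd is the empty one, whence the positivity of \<open>n\<close>.
\<close>

lemma uniform_overpartitions_eq:
  shows "uniform_overpartitions n = even_overpartitions n \<union> C n"
    and "0 < n \<Longrightarrow> even_overpartitions n \<inter> C n = {}"
proof -
  have sub: "x \<in># parts p" if "x \<in># nonoverlined p" for p x
    using that by (auto simp: nonoverlined_def dest: in_diffD)
  show "uniform_overpartitions n = even_overpartitions n \<union> C n"
    unfolding uniform_overpartitions_def even_overpartitions_def C_def even_add
    using sub odd_one by blast
  show "even_overpartitions n \<inter> C n = {}" if "0 < n"
  proof -
    have "parts p \<noteq> {#}" if "p \<in> overpartitions n" for p
      using that \<open>0 < n\<close> by (auto simp: overpartitions_def)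
    then show ?thesis
      unfolding even_overpartitions_def C_def by (fast elim: multiset_nonemptyE)
  qed
qed

lemma finite_even_overpartitions: "finite (even_overpartitions n)"
  and finite_C: "finite (C n)"
  and finite_uniform_overpartitions: "finite (uniform_overpartitions n)"
  by (auto intro: finite_subset[OF _ finite_overpartitions]
      simp: even_overpartitions_def C_def uniform_overpartitions_def)

text \<open>
  The predicate \<open>Q\<close> is arbitrary, so this is an identity for each number of larger parts separately;
  the parity statements are the cases \<open>Q = even\<close> and \<open>Q = odd\<close>.
\<close>

lemma card_Sptko_refined:
  assumes "1 < n"
  shows "card {p \<in> Sptko 1 n. Q (num_greater p)} + card {p \<in> Sptko 1 (n - 2). Q (num_greater p)} =
         card {p \<in> even_overpartitions (n - 1). Q (size (parts p))} +
         card {p \<in> even_overpartitions (n - 1). Q (size (parts p) - 1)} +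
         card {p \<in> C (n - 1). Q (size (parts p) - 1)}"
proof -
  let ?A = "split_spt n" and ?U = "uniform_overpartitions (n - 1)"
  have "card {t \<in> ?A. Q (larger_parts t)} =
      card {t \<in> {t \<in> ?A. fst t = 1} \<union> {t \<in> ?A. fst t \<noteq> 1}. Q (larger_parts t)}"
    by (rule arg_cong[where f=card]) blast
  also have "\<dots> = card {t \<in> {t \<in> ?A. fst t = 1}. Q (larger_parts t)} +
      card {t \<in> {t \<in> ?A. fst t \<noteq> 1}. Q (larger_parts t)}"
    by (rule card_filter_disjoint_Un) (auto simp: finite_split_spt)
  finally have split_A: "card {t \<in> ?A. Q (larger_parts t)} = \<dots>" .
  have deleted: "card {t \<in> {t \<in> ?A. fst t = 1}. Q (larger_parts t)} =
      card {p \<in> even_overpartitions (n - 1). Q (size (parts p))}"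
    using assms by (intro card_filter_bij_betw[OF bij_betw_delete_one, where Q=Q and st="\<lambda>p. size (parts p)"
        and st'=larger_parts]) (auto simp: larger_parts_def)
  have overlined: "card {t \<in> {t \<in> ?A. fst t \<noteq> 1}. Q (larger_parts t)} =
      card {p \<in> {p \<in> ?U. min_overlined_only p}. Q (size (parts p) - 1)}"
    by (rule card_filter_bij_betw[OF bij_betw_overlined_pred[OF assms], where Q=Q and st="\<lambda>p. size (parts p) - 1"
        and st'=larger_parts])
       (auto simp: larger_parts_def parts_def)
  have nonoverlined: "card {t \<in> split_spt (n - 2). Q (larger_parts t)} =
      card {p \<in> {p \<in> ?U. \<not> min_overlined_only p}. Q (size (parts p) - 1)}"
    by (rule card_filter_bij_betw[OF bij_betw_nonoverlined_succ[OF assms], where Q=Q and st="\<lambda>p. size (parts p) - 1"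
        and st'=larger_parts])
       (auto simp: larger_parts_def parts_def)
  have "card {p \<in> {p \<in> ?U. min_overlined_only p}. Q (size (parts p) - 1)} +
      card {p \<in> {p \<in> ?U. \<not> min_overlined_only p}. Q (size (parts p) - 1)} =
      card {p \<in> {p \<in> ?U. min_overlined_only p} \<union> {p \<in> ?U. \<not> min_overlined_only p}.
        Q (size (parts p) - 1)}"
    by (rule card_filter_disjoint_Un[symmetric]) (auto simp: finite_uniform_overpartitions)
  also have "\<dots> = card {p \<in> even_overpartitions (n - 1) \<union> C (n - 1). Q (size (parts p) - 1)}"
    unfolding uniform_overpartitions_eq(1)[symmetric] by (rule arg_cong[where f=card]) blast
  also have "\<dots> = card {p \<in> even_overpartitions (n - 1). Q (size (parts p) - 1)} +
      card {p \<in> C (n - 1). Q (size (parts p) - 1)}"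
    using assms by (intro card_filter_disjoint_Un uniform_overpartitions_eq(2)
        finite_even_overpartitions finite_C) simp
  finally show ?thesis
    using split_A deleted overlined nonoverlined unfolding card_Sptko_eq_split_spt by linarith
qed

text \<open>
  When \<open>Q\<close> changes with every added part, the two contributions of the even overpartitions in
  \<open>card_Sptko_refined\<close> are complementary and add up to all of them.
\<close>

lemma card_Sptko_alternating:
  assumes "1 < n" and Q: "\<And>m. 0 < m \<Longrightarrow> Q (m - 1) \<longleftrightarrow> \<not> Q m"
  shows "card {p \<in> Sptko 1 n. Q (num_greater p)} + card {p \<in> Sptko 1 (n - 2). Q (num_greater p)} =
         pbar_e (n - 1) + card {p \<in> C (n - 1). \<not> Q (size (parts p))}"
proof -
  have pos: "0 < size (parts p)" if "p \<in> overpartitions (n - 1)" for p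
    using that assms(1) by (auto simp: overpartitions_def nonempty_has_size[symmetric])
  let ?E = "even_overpartitions (n - 1)"
  have E: "{p \<in> ?E. Q (size (parts p) - 1)} = {p \<in> ?E. \<not> Q (size (parts p))}"
    using pos Q by (auto simp: even_overpartitions_def)
  have C: "{p \<in> C (n - 1). Q (size (parts p) - 1)} = {p \<in> C (n - 1). \<not> Q (size (parts p))}"
    using pos Q by (auto simp: C_def)
  have "card {p \<in> ?E. Q (size (parts p))} + card {p \<in> ?E. \<not> Q (size (parts p))} =
      card ({p \<in> ?E. Q (size (parts p))} \<union> {p \<in> ?E. \<not> Q (size (parts p))})"
    by (rule card_Un_disjoint[symmetric]) (auto simp: finite_even_overpartitions)
  also have "{p \<in> ?E. Q (size (parts p))} \<union> {p \<in> ?E. \<not> Q (size (parts p))} = ?E" by blast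
  also have "card ?E = pbar_e (n - 1)" by (simp add: pbar_e_def even_overpartitions_def)
  finally show ?thesis
    using card_Sptko_refined[OF assms(1), of Q] unfolding E C by linarith
qed

theorem theorem1p4:
  fixes n :: nat
  assumes "n > 2"
  shows "b_e 1 n + b_e 1 (n - 2) = pbar_e (n - 1) + c_o (n - 1) \<and>
         b_o 1 n + b_o 1 (n - 2) = pbar_e (n - 1) + c_e (n - 1)"
  using card_Sptko_alternating[of n even] card_Sptko_alternating[of n odd] assms
  by (simp add: b_e_def b_o_def c_e_def c_o_def)

end
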